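(* Suppose that $\Omega=\{0,1\}^{\mathbb{N}}=\{\{a_i\}_{i\in\mathbb{N}}:a_i\in\{0,1\}\}$ with the set of evaluation functions $\Lambda$ equal to the set of pointwise evaluations $\{\lambda_{j}(a):=a_j:j\in\mathbb{N}\}$ and let $\mathcal{M}$ be an arbitrary separable metric space with at least two separated (i.e. distinct) points. Endow $\Omega$ with the product topology $\tilde{\mathcal{T}}$ induced by the discrete topology on $\{0,1\}$ and consider the Baire hierarchy $\{\mathcal{B}_{\xi}((\Omega,\tilde{\mathcal{T}}),\mathcal{M})=\mathcal{B}_{\xi}\}_{\xi<\omega_1}$ of functions $\Omega\rightarrow\mathcal{M}$. Then for any problem function $\Xi:\Omega\rightarrow\mathcal{M}$ and $m\in\mathbb{N}$ ($m\ge1$), $$\{\Xi,\Omega,\Lambda\}\in\Delta^G_{m+1}\ \Longleftrightarrow\ \Xi\in\mathcal{B}_{m}.$$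
   Context: **Baire hierarchy.** For metric (metrizable) spaces $X,Y$: a function $h:X\to Y$ is in $\mathcal{B}_1$ if for every open $U\subset Y$ the set $h^{-1}(U)$ is a countable union of closed subsets of $X$. For $1<\xi<\omega_1$, $h\in\mathcal{B}_\xi$ if $h$ is the pointwise limit of a sequence of functions $h_n\in\mathcal{B}_{\xi_n}$ with $\xi_n<\xi$. **SCI hierarchy.** A *general algorithm* is a map $\Gamma:\Omega\to\mathcal{M}$ such that for each $a\in\Omega$ there is a non-empty finite set $\Lambda_\Gamma(a)\subset\Lambda$ such that (i) $\Gamma(a)$ depends only on $\{h(a)\}_{h\in\Lambda_\Gamma(a)}$, and (ii) if $b\in\Omega$ satisfies $h(b)=h(a)$ for all $h\in\Lambda_\Gamma(a)$, then $\Lambda_\Gamma(b)=\Lambda_\Gamma(a)$ (hence $\Gamma(b)=\Gamma(a)$). A (general) *tower of algorithms of height $m$* for $\Xi$ is a family of maps $\Gamma_{n_m},\Gamma_{n_m,n_{m-1}},\ldots,\Gamma_{n_m,\ldots,n_1}:\Omega\to\mathcal{M}$, $n_j\in\mathbb{N}$, where the $\Gamma_{n_m,\ldots,n_1}$ are general algorithms and for every $a\in\Omega$: $\Xi(a)=\lim_{n_m\to\infty}\Gamma_{n_m}(a)$ and $\Gamma_{n_m,\ldots,n_{j+1}}(a)=\lim_{n_j\to\infty}\Gamma_{n_m,\ldots,n_j}(a)$ for $j=m-1,\ldots,1$. For $m\ge1$, $\{\Xi,\Omega,\Lambda\}\in\Delta^G_{m+1}$ means that there is a tower of general algorithms of height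 at most $m$ for $\Xi$. *)

theory Defs
  imports "HOL-Analysis.Analysis"
begin

section \<open>The Baire hierarchy\<close>

text \<open>
  The Baire class of order \<open>\<xi>\<close> of functions on the (metrizable) space \<open>X\<close>, for finite \<open>\<xi> \<ge> 1\<close>.
  Class \<open>\<xi>\<close> refers only to classes of smaller order, so the finite levels of the hierarchy indexed
  by countable ordinals are generated by these rules alone; there is no level 0.
  Only the values on \<open>topspace X\<close> matter.
\<close>

inductive baire_class :: "'a topology \<Rightarrow> nat \<Rightarrow> ('a \<Rightarrow> 'm::metric_space) \<Rightarrow> bool" for X where
  baire_one:
    "(\<And>U. open U \<Longrightarrow> fsigma_in X {x \<in> topspace X. h x \<in> U}) \<Longrightarrow> baire_class X 1 h"
| baire_limit:
    "\<lbrakk>1 < \<xi>; \<And>n. 1 \<le> \<xi>s n \<and> \<xi>s n < \<xi>; \<And>n. baire_class X (\<xi>s n) (hs n);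
      \<And>x. x \<in> topspace X \<Longrightarrow> (\<lambda>n. hs n x) \<longlonglongrightarrow> h x\<rbrakk> \<Longrightarrow> baire_class X \<xi> h"

section \<open>General algorithms and the SCI hierarchy\<close>

text \<open>
  \<open>L a\<close> is the finite set of evaluations read by the algorithm on input \<open>a\<close>.
\<close>

definition general_algorithm :: "'a set \<Rightarrow> ('a \<Rightarrow> 'v) set \<Rightarrow> ('a \<Rightarrow> 'm) \<Rightarrow> bool" where
  "general_algorithm \<Omega> \<Lambda> \<Gamma> \<longleftrightarrow>
     (\<exists>L. \<forall>a\<in>\<Omega>.
        L a \<subseteq> \<Lambda> \<and> finite (L a) \<and> L a \<noteq> {} \<and>
        (\<forall>b\<in>\<Omega>. (\<forall>h\<in>L a. h b = h a) \<longrightarrow> \<Gamma> b = \<Gamma> a) \<and>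
        (\<forall>b\<in>\<Omega>. (\<forall>h\<in>L a. h b = h a) \<longrightarrow> L b = L a))"

text \<open>
  The maps of a tower are indexed by lists: \<open>\<Gamma> [n\<^sub>m, \<dots>, n\<^sub>j]\<close> is the map with subscript
  \<open>n\<^sub>m, \<dots>, n\<^sub>j\<close>. Only lists of length between 1 and the height \<open>m \<ge> 1\<close> are relevant.
\<close>

definition is_tower ::
  "'a set \<Rightarrow> ('a \<Rightarrow> 'v) set \<Rightarrow> ('a \<Rightarrow> 'm::metric_space) \<Rightarrow> nat \<Rightarrow> (nat list \<Rightarrow> 'a \<Rightarrow> 'm) \<Rightarrow> bool" where
  "is_tower \<Omega> \<Lambda> \<Xi> m \<Gamma> \<longleftrightarrow>
     1 \<le> m \<and>
     (\<forall>ns. length ns = m \<longrightarrow> general_algorithm \<Omega> \<Lambda> (\<Gamma> ns)) \<and>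
     (\<forall>a\<in>\<Omega>. (\<lambda>n. \<Gamma> [n] a) \<longlonglongrightarrow> \<Xi> a) \<and>
     (\<forall>a\<in>\<Omega>. \<forall>ns. 1 \<le> length ns \<and> length ns < m \<longrightarrow> (\<lambda>n. \<Gamma> (ns @ [n]) a) \<longlonglongrightarrow> \<Gamma> ns a)"

text \<open>
  \<open>Delta_G k\<close> is the class \<open>\<Delta>\<^sup>G\<close> with subscript \<open>k\<close>; it is meaningful for \<open>k \<ge> 2\<close> only.
\<close>

definition Delta_G ::
  "nat \<Rightarrow> (('a \<Rightarrow> 'm::metric_space) \<times> 'a set \<times> ('a \<Rightarrow> 'v) set) set" where
  "Delta_G k = {(\<Xi>, \<Omega>, \<Lambda>). \<exists>m \<Gamma>. m \<le> k - 1 \<and> is_tower \<Omega> \<Lambda> \<Xi> m \<Gamma>}"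

section \<open>Binary sequences\<close>

definition binary_seqs :: "(nat \<Rightarrow> nat) set" where
  "binary_seqs = {a. \<forall>i. a i \<in> {0, 1}}"

definition pointwise_evals :: "((nat \<Rightarrow> nat) \<Rightarrow> nat) set" where
  "pointwise_evals = {\<lambda>a. a j |j. True}"

definition binary_topology :: "(nat \<Rightarrow> nat) topology" where
  "binary_topology = product_topology (\<lambda>i. discrete_topology {0, 1}) UNIV"

lemma topspace_binary_topology [simp]: "topspace binary_topology = binary_seqs"
  by (simp add: binary_topology_def binary_seqs_def PiE_UNIV_domain Pi_def)

end

theory Submission
  imports Defs
begin

text \<open>
  A general algorithm on binary sequences reads finitely many digits, so it is locally constant;
  conversely every function of a prefix of fixed length is a general algorithm.  A tower of height
  \<open>m\<close> is therefore an \<open>m\<close>-fold iterated pointwise limit of locally constant functions.  Peeling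
  off the outermost limit (\<open>is_tower_Suc_iff\<close>) matches the recursive clause of the Baire
  hierarchy, so everything reduces to height 1, that is, to the claim that, for a separable
  target, the functions with \<open>F\<^sub>\<sigma>\<close> preimages of open sets are exactly the pointwise limits of general algorithms.

  That such limits have \<open>F\<^sub>\<sigma>\<close> preimages is a standard computation
  (\<open>fsigma_in_preimage_pointwise_limit\<close>).  The converse is the version of the theorem of
  Lebesgue, Hausdorff and Banach for a zero-dimensional domain
  (\<open>baire_one_imp_limit_of_algorithms\<close>).  Fix a dense sequence in the target.
  For each \<open>k\<close> the domain is a countable union of closed sets \<open>C k n\<close> on each of which the function
  stays within \<open>2\<^sup>-\<^sup>k\<close> of a member \<open>y n\<close> of the sequence.  Not belonging to a closed set is witnessed by a finite
  prefix, so the least \<open>n\<close> for which \<open>C k n\<close> is still compatible with the first \<open>j\<close> digits of \<open>x\<close>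
  stabilises, as \<open>j\<close> grows, at the least \<open>n\<close> with \<open>x \<in> C k n\<close>.  Before stabilisation the guesses
  for different \<open>k\<close> may contradict each other.  The algorithm answers with the guess
  of the finest scale \<open>k\<close> up to which no contradiction is visible; then the guesses at coarse scales,
  once correct, control all finer ones.
\<close>

section \<open>Open sets and general algorithms on binary sequences\<close>

lemma openin_binary_topology_iff:
  "openin binary_topology U \<longleftrightarrow>
     U \<subseteq> binary_seqs \<and> (\<forall>x\<in>U. \<exists>N. \<forall>z\<in>binary_seqs. (\<forall>i<N. z i = x i) \<longrightarrow> z \<in> U)"
  (is "?L \<longleftrightarrow> ?R")
proof
  assume U: ?L
  have sub: "U \<subseteq> binary_seqs"
    using openin_subset[OF U] by simp
  have "\<exists>N. \<forall>z\<in>binary_seqs. (\<forall>i<N. z i = x i) \<longrightarrow> z \<in> U" if x: "x \<in> U" for x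
  proof -
    obtain V where V: "finite {i. V i \<noteq> {0, 1::nat}}" "x \<in> Pi\<^sub>E UNIV V" "Pi\<^sub>E UNIV V \<subseteq> U"
      using U x unfolding binary_topology_def openin_product_topology_alt by auto
    obtain N where N: "\<And>i. V i \<noteq> {0, 1} \<Longrightarrow> i < N"
      using V(1) finite_nat_set_iff_bounded by auto
    have "z \<in> U" if z: "z \<in> binary_seqs" "\<forall>i<N. z i = x i" for z
    proof -
      have "z i \<in> V i" for i
      proof (cases "i < N")
        case True
        then show ?thesis using z(2) V(2) by (auto simp: PiE_UNIV_domain)
      next
        case False
        then have "V i = {0, 1}" using N by blast
        then show ?thesis using z(1) by (simp add: binary_seqs_def)
      qed
      then show ?thesis using V(3) by (auto simp: PiE_UNIV_domain)
    qed
    then show ?thesis by blast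
  qed
  with sub show ?R by blast
next
  assume R: ?R
  show ?L
  proof (subst openin_subopen, intro ballI)
    fix x assume x: "x \<in> U"
    then obtain N where N: "\<And>z. z \<in> binary_seqs \<Longrightarrow> \<forall>i<N. z i = x i \<Longrightarrow> z \<in> U"
      using R by blast
    define V where "V i = (if i < N then {x i} else {0, 1})" for i
    have xb: "x i \<in> {0, 1}" for i
      using R x by (auto simp: binary_seqs_def)
    have "openin binary_topology (Pi\<^sub>E UNIV V)"
      unfolding binary_topology_def
    proof (rule product_topology_basis)
      show "openin (discrete_topology {0, 1}) (V i)" for i
        using xb by (auto simp: V_def)
      show "finite {i. V i \<noteq> topspace (discrete_topology {0, 1})}"
        by (rule finite_subset[of _ "{..<N}"]) (auto simp: V_def)
    qed
    moreover have "x \<in> Pi\<^sub>E UNIV V"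
      using xb by (auto simp: V_def PiE_UNIV_domain)
    moreover have "Pi\<^sub>E UNIV V \<subseteq> U"
    proof
      fix z assume z: "z \<in> Pi\<^sub>E UNIV V"
      then have zV: "z i \<in> V i" for i by (auto simp: PiE_UNIV_domain)
      have "z i \<in> {0, 1}" for i
        using zV[of i] xb[of i] by (auto simp: V_def split: if_splits)
      moreover have "z i = x i" if "i < N" for i
        using zV[of i] that by (simp add: V_def)
      ultimately show "z \<in> U"
        by (intro N) (simp_all add: binary_seqs_def)
    qed
    ultimately show "\<exists>T. openin binary_topology T \<and> x \<in> T \<and> T \<subseteq> U" by blast
  qed
qed

lemma general_algorithm_openin_preimage:
  assumes "general_algorithm binary_seqs pointwise_evals \<Gamma>"
  shows "openin binary_topology {x \<in> binary_seqs. \<Gamma> x \<in> V}"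
  unfolding openin_binary_topology_iff
proof (intro conjI ballI)
  fix x assume x: "x \<in> {x \<in> binary_seqs. \<Gamma> x \<in> V}"
  have xb: "x \<in> binary_seqs" using x by simp
  obtain L where "\<forall>a\<in>binary_seqs. L a \<subseteq> pointwise_evals \<and> finite (L a) \<and> L a \<noteq> {} \<and>
      (\<forall>b\<in>binary_seqs. (\<forall>h\<in>L a. h b = h a) \<longrightarrow> \<Gamma> b = \<Gamma> a) \<and>
      (\<forall>b\<in>binary_seqs. (\<forall>h\<in>L a. h b = h a) \<longrightarrow> L b = L a)"
    using assms unfolding general_algorithm_def by (rule exE)
  from bspec[OF this xb] obtain H where H: "H \<subseteq> pointwise_evals" "finite H"
    "\<And>b. b \<in> binary_seqs \<Longrightarrow> \<forall>h\<in>H. h b = h x \<Longrightarrow> \<Gamma> b = \<Gamma> x"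
    by auto
  have "H \<subseteq> range (\<lambda>j a. a j)"
    using H(1) by (auto simp: pointwise_evals_def)
  then obtain J where J: "finite J" "H = (\<lambda>j a. a j) ` J"
    using finite_subset_image[OF H(2)] by blast
  obtain N where N: "\<forall>j\<in>J. j < N"
    using J(1) finite_nat_set_iff_bounded by blast
  have "z \<in> {x \<in> binary_seqs. \<Gamma> x \<in> V}" if z: "z \<in> binary_seqs" "\<forall>i<N. z i = x i" for z
  proof -
    have "\<Gamma> z = \<Gamma> x"
      using z N J(2) by (intro H(3)) auto
    with z(1) x show ?thesis by simp
  qed
  then show "\<exists>N. \<forall>z\<in>binary_seqs. (\<forall>i<N. z i = x i) \<longrightarrow> z \<in> {x \<in> binary_seqs. \<Gamma> x \<in> V}"
    by blast
qed simp

lemma general_algorithm_closedin_preimage: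
  assumes "general_algorithm binary_seqs pointwise_evals \<Gamma>"
  shows "closedin binary_topology {x \<in> binary_seqs. \<Gamma> x \<in> V}"
proof -
  have "binary_seqs - {x \<in> binary_seqs. \<Gamma> x \<in> V} = {x \<in> binary_seqs. \<Gamma> x \<in> - V}" by auto
  then show ?thesis
    using general_algorithm_openin_preimage[OF assms, of "- V"] by (auto simp: closedin_def)
qed

lemma general_algorithm_of_prefix:
  assumes "\<And>x z. \<forall>i<j. z i = x i \<Longrightarrow> \<Gamma> z = \<Gamma> x"
  shows "general_algorithm binary_seqs pointwise_evals \<Gamma>"
  unfolding general_algorithm_def
proof (intro exI ballI conjI impI)
  \<comment> \<open>One digit more than the prefix is read, because the set of evaluations may not be empty.\<close>
  let ?L = "\<lambda>_. (\<lambda>i a. a i) ` {..j}"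
  fix a b :: "nat \<Rightarrow> nat"
  show "?L a \<subseteq> pointwise_evals" by (auto simp: pointwise_evals_def)
  show "finite (?L a)" "?L a \<noteq> {}" by simp_all
  show "?L b = ?L a" by simp
  assume "\<forall>h\<in>?L a. h b = h a"
  then have "\<forall>i<j. b i = a i" by simp
  then show "\<Gamma> b = \<Gamma> a" by (rule assms)
qed

section \<open>Limits of general algorithms are of the first Baire class\<close>

text \<open>
  The open set \<open>U\<close> is exhausted by the closed sets \<open>F k\<close> of points at distance at least
  \<open>1 / (k + 1)\<close> from the complement.  A limit lies in \<open>U\<close> iff for some \<open>k\<close> the sequence is
  eventually in \<open>F k\<close>.
\<close>

lemma fsigma_in_preimage_pointwise_limit:
  fixes g :: "nat \<Rightarrow> 'a \<Rightarrow> 'm::metric_space"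
  assumes closed_preimage: "\<And>n K. closed K \<Longrightarrow> closedin X {x \<in> topspace X. g n x \<in> K}"
    and lim: "\<And>x. x \<in> topspace X \<Longrightarrow> (\<lambda>n. g n x) \<longlonglongrightarrow> h x"
    and U: "open U"
  shows "fsigma_in X {x \<in> topspace X. h x \<in> U}"
proof -
  define F where "F k = {y. ball y (inverse (real (Suc k))) \<subseteq> U}" for k
  have F_closed: "closed (F k)" for k
  proof -
    have "- F k = (\<Union>z\<in>- U. ball z (inverse (real (Suc k))))"
      by (auto simp: F_def subset_iff dist_commute)
    then show ?thesis by (simp add: closed_def open_UN)
  qed
  have F_sub: "F k \<subseteq> U" for k
    unfolding F_def using centre_in_ball[of _ "inverse (real (Suc k))"] by fastforce
  define S where "S k N = (\<Inter>n\<in>{N..}. {x \<in> topspace X. g n x \<in> F k})" for k N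
  have S_closed: "closedin X (S k N)" for k N
    unfolding S_def by (intro closedin_INT closed_preimage F_closed) auto
  have "h x \<in> U \<longleftrightarrow> (\<exists>k N. x \<in> S k N)" if x: "x \<in> topspace X" for x
  proof
    assume "h x \<in> U"
    then obtain e where e: "e > 0" "ball (h x) e \<subseteq> U"
      using U openE by blast
    obtain k where k: "inverse (real (Suc k)) < e / 2"
      using reals_Archimedean[of "e / 2"] e(1) by auto
    obtain N where N: "\<And>n. n \<ge> N \<Longrightarrow> dist (g n x) (h x) < e / 2"
      using metric_LIMSEQ_D[OF lim[OF x], of "e / 2"] e(1) by auto
    have "g n x \<in> F k" if n: "n \<ge> N" for n
    proof -
      have "ball (g n x) (inverse (real (Suc k))) \<subseteq> ball (h x) e"
      proof
        fix z assume "z \<in> ball (g n x) (inverse (real (Suc k)))"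
        then have "dist (g n x) z < e / 2" using k by auto
        moreover have "dist (h x) z \<le> dist (g n x) (h x) + dist (g n x) z"
          by (metis dist_commute dist_triangle)
        ultimately show "z \<in> ball (h x) e" using N[OF n] by auto
      qed
      with e(2) show ?thesis by (auto simp: F_def)
    qed
    then show "\<exists>k N. x \<in> S k N" using x by (auto simp: S_def)
  next
    assume "\<exists>k N. x \<in> S k N"
    then obtain k N where "\<And>n. n \<ge> N \<Longrightarrow> g n x \<in> F k" by (auto simp: S_def)
    then have "\<forall>\<^sub>F n in sequentially. g n x \<in> F k"
      by (auto simp: eventually_sequentially)
    then have "h x \<in> F k"
      using Lim_in_closed_set[OF F_closed _ _ lim[OF x]] by simp
    then show "h x \<in> U" using F_sub by blast
  qed
  moreover have "S k N \<subseteq> topspace X" for k N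
    using S_closed closedin_subset by blast
  ultimately have "{x \<in> topspace X. h x \<in> U} = (\<Union>p. S (fst p) (snd p))"
    by auto
  moreover have "fsigma_in X (\<Union>p. S (fst p) (snd p))"
    by (intro fsigma_in_Union) (auto intro: closed_imp_fsigma_in S_closed)
  ultimately show ?thesis by simp
qed

section \<open>Functions of the first Baire class are limits of general algorithms\<close>

definition meets_prefix :: "(nat \<Rightarrow> 'v) set \<Rightarrow> nat \<Rightarrow> (nat \<Rightarrow> 'v) \<Rightarrow> bool" where
  "meets_prefix C j x \<longleftrightarrow> (\<exists>z\<in>C. \<forall>i<j. z i = x i)"

lemma meets_prefix_cong: "\<forall>i<j. z i = x i \<Longrightarrow> meets_prefix C j z \<longleftrightarrow> meets_prefix C j x"
  by (auto simp: meets_prefix_def)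

lemma meets_prefix_mem: "x \<in> C \<Longrightarrow> meets_prefix C j x"
  by (auto simp: meets_prefix_def)

lemma eventually_not_meets_prefix:
  assumes "closedin binary_topology C" "x \<in> binary_seqs" "x \<notin> C"
  shows "\<forall>\<^sub>F j in sequentially. \<not> meets_prefix C j x"
proof -
  have C: "C \<subseteq> binary_seqs" "openin binary_topology (binary_seqs - C)"
    using assms(1) by (auto simp: closedin_def)
  obtain N where N: "\<And>z. z \<in> binary_seqs \<Longrightarrow> \<forall>i<N. z i = x i \<Longrightarrow> z \<notin> C"
    using C(2) assms(2,3) unfolding openin_binary_topology_iff by blast
  have "\<not> meets_prefix C j x" if "j \<ge> N" for j
    using N C(1) that unfolding meets_prefix_def by (meson less_le_trans subsetD)
  then show ?thesis by (auto simp: eventually_sequentially)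
qed

text \<open>
  Each wrong candidate before the first correct one is refuted by a finite prefix, and there are
  only finitely many of them.
\<close>

lemma eventually_least_meets_prefix:
  fixes C :: "nat \<Rightarrow> (nat \<Rightarrow> nat) set"
  assumes closed: "\<And>n. closedin binary_topology (C n)"
    and x: "x \<in> binary_seqs" and ex: "\<exists>n. x \<in> C n"
  shows "\<forall>\<^sub>F j in sequentially. x \<in> C (LEAST n. meets_prefix (C n) j x)"
proof -
  define n0 where "n0 = (LEAST n. x \<in> C n)"
  have n0: "x \<in> C n0" "\<And>n. n < n0 \<Longrightarrow> x \<notin> C n"
    unfolding n0_def using LeastI_ex[of "\<lambda>n. x \<in> C n"] ex not_less_Least[of _ "\<lambda>n. x \<in> C n"]
    by blast+
  have "\<forall>\<^sub>F j in sequentially. \<forall>n\<in>{..<n0}. \<not> meets_prefix (C n) j x"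
    using n0(2) by (intro eventually_ball_finite) (auto intro: eventually_not_meets_prefix closed x)
  then show ?thesis
  proof eventually_elim
    case (elim j)
    have "(LEAST n. meets_prefix (C n) j x) = n0"
    proof (rule Least_equality)
      show "meets_prefix (C n0) j x" using n0(1) by (rule meets_prefix_mem)
      show "n0 \<le> n" if "meets_prefix (C n) j x" for n
        using elim that by (meson lessThan_iff not_less)
    qed
    then show ?case using n0(1) by simp
  qed
qed

text \<open>
  Combination of approximations of a point \<open>p\<close> at all scales, where the approximation at scale
  \<open>k\<close> is only known to be correct from some stage \<open>j\<close> on that depends on \<open>k\<close>.  Consistency of
  the scales up to \<open>k\<close> is the condition that the balls in question could have a common point; correct
  approximations pass this test, and an incorrect one that passes it cannot be far from the coarser
  ones.
\<close>

definition consistent_upto :: "(nat \<Rightarrow> 'm::metric_space) \<Rightarrow> nat \<Rightarrow> bool" where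
  "consistent_upto q k \<longleftrightarrow> (\<forall>l\<le>k. \<forall>l'\<le>k. dist (q l) (q l') < (1/2)^l + (1/2)^l')"

definition finest_consistent :: "(nat \<Rightarrow> 'm::metric_space) \<Rightarrow> nat \<Rightarrow> 'm" where
  "finest_consistent q j = q (GREATEST k. k \<le> j \<and> consistent_upto q k)"

lemma finest_consistent_tendsto:
  fixes p :: "'m::metric_space"
  assumes ev: "\<And>k. \<forall>\<^sub>F j in sequentially. dist (q j k) p < (1/2)^k"
  shows "(\<lambda>j. finest_consistent (q j) j) \<longlonglongrightarrow> p"
proof (rule metric_LIMSEQ_I)
  fix e :: real assume e: "e > 0"
  obtain K where K: "(1/2)^K < e / 3"
    using real_arch_pow_inv[of "e/3" "1/2"] e by auto
  have "\<forall>\<^sub>F j in sequentially. \<forall>k\<in>{..K}. dist (q j k) p < (1/2)^k"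
    using ev by (intro eventually_ball_finite) auto
  then have "\<forall>\<^sub>F j in sequentially. dist (finest_consistent (q j) j) p < e"
    using eventually_ge_at_top[of K]
  proof eventually_elim
    case (elim j)
    have "dist (q j l) (q j l') < (1/2)^l + (1/2)^l'" if "l \<le> K" "l' \<le> K" for l l'
    proof -
      have "dist (q j l) p < (1/2)^l" "dist (q j l') p < (1/2)^l'"
        using elim(1) that by auto
      then show ?thesis
        using dist_triangle2[of "q j l" "q j l'" p] by linarith
    qed
    then have cK: "K \<le> j \<and> consistent_upto (q j) K"
      using elim(2) by (auto simp: consistent_upto_def)
    define k where "k = (GREATEST k. k \<le> j \<and> consistent_upto (q j) k)"
    have k: "consistent_upto (q j) k" "K \<le> k"
      using GreatestI_nat[of "\<lambda>k. k \<le> j \<and> consistent_upto (q j) k", OF cK, of j]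
        Greatest_le_nat[of "\<lambda>k. k \<le> j \<and> consistent_upto (q j) k", OF cK, of j]
      by (auto simp: k_def)
    have "dist (q j k) (q j K) < (1/2)^k + (1/2)^K"
      using k by (auto simp: consistent_upto_def)
    moreover have "(1/2::real)^k \<le> (1/2)^K"
      using k(2) by (intro power_decreasing) auto
    moreover have "dist (q j K) p < (1/2)^K"
      using elim(1) by auto
    moreover have "dist (q j k) p \<le> dist (q j k) (q j K) + dist (q j K) p"
      by (rule dist_triangle)
    ultimately show ?case
      using K unfolding finest_consistent_def k_def[symmetric] by linarith
  qed
  then show "\<exists>no. \<forall>n\<ge>no. dist (finest_consistent (q n) n) p < e"
    by (simp add: eventually_sequentially)
qed

lemma baire_one_imp_limit_of_algorithms:
  fixes h :: "(nat \<Rightarrow> nat) \<Rightarrow> 'm::metric_space"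
  assumes separable: "\<exists>D::'m set. countable D \<and> closure D = UNIV"
    and fsigma: "\<And>U. open U \<Longrightarrow> fsigma_in binary_topology {x \<in> binary_seqs. h x \<in> U}"
  shows "\<exists>\<Gamma>. (\<forall>j. general_algorithm binary_seqs pointwise_evals (\<Gamma> j)) \<and>
    (\<forall>x\<in>binary_seqs. (\<lambda>j. \<Gamma> j x) \<longlonglongrightarrow> h x)"
proof -
  obtain D :: "'m set" where D: "countable D" "closure D = UNIV"
    using separable by blast
  then have "D \<noteq> {}" by auto
  define d where "d = from_nat_into D"
  have dense: "\<exists>i. dist (d i) y < r" if "r > 0" for y r
  proof -
    have "y \<in> closure D" using D(2) by simp
    then obtain z where "z \<in> D" "dist z y < r"
      using \<open>r > 0\<close> closure_approachable by blast
    then show ?thesis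
      using from_nat_into_surj[OF D(1)] by (auto simp: d_def)
  qed
  have "\<forall>i k. \<exists>C. (\<forall>n::nat. closedin binary_topology (C n)) \<and>
      \<Union> (range C) = {x \<in> binary_seqs. h x \<in> ball (d i) ((1/2)^k)}"
  proof (intro allI)
    fix i k :: nat
    have "fsigma_in binary_topology {x \<in> binary_seqs. h x \<in> ball (d i) ((1/2)^k)}"
      by (rule fsigma) simp
    then obtain C where "(\<forall>n. closedin binary_topology (C n)) \<and> (\<forall>n. C n \<subseteq> C (Suc n)) \<and>
        \<Union> (range C) = {x \<in> binary_seqs. h x \<in> ball (d i) ((1/2)^k)}"
      unfolding fsigma_in_ascending by (rule exE)
    then show "\<exists>C. (\<forall>n::nat. closedin binary_topology (C n)) \<and>
        \<Union> (range C) = {x \<in> binary_seqs. h x \<in> ball (d i) ((1/2)^k)}"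
      by (intro exI[of _ C]) simp
  qed
  from this[unfolded choice_iff] obtain C
    where "\<forall>i k. (\<forall>n::nat. closedin binary_topology (C i k n)) \<and>
      \<Union> (range (C i k)) = {x \<in> binary_seqs. h x \<in> ball (d i) ((1/2)^k)}"
    by (rule exE)
  then have C: "closedin binary_topology (C i k n)"
    "\<Union> (range (C i k)) = {x \<in> binary_seqs. h x \<in> ball (d i) ((1/2)^k)}" for i k n
    by simp_all
  \<comment> \<open>One enumeration for each scale \<open>k\<close>: the code \<open>n\<close> stands for a centre and a closed piece
    of the preimage of the ball around it.\<close>
  define E where "E k n = (case prod_decode n of (i, l) \<Rightarrow> C i k l)" for k n
  define y where "y n = d (fst (prod_decode n))" for n
  have E_closed: "closedin binary_topology (E k n)" for k n
    using C(1) by (simp add: E_def split: prod.split)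
  have E_near: "dist (y n) (h x) < (1/2)^k" if "x \<in> E k n" for k n x
  proof -
    obtain i l where il: "prod_decode n = (i, l)" by fastforce
    then have "x \<in> \<Union> (range (C i k))" using that by (auto simp: E_def)
    then show ?thesis using il unfolding C(2) by (simp add: y_def)
  qed
  have E_cover: "\<exists>n. x \<in> E k n" if x: "x \<in> binary_seqs" for k x
  proof -
    obtain i where "dist (d i) (h x) < (1/2)^k"
      using dense[of "(1/2)^k" "h x"] by auto
    then have "x \<in> \<Union> (range (C i k))" using x unfolding C(2) by simp
    then obtain l where "x \<in> C i k l" by blast
    then have "x \<in> E k (prod_encode (i, l))" by (simp add: E_def)
    then show ?thesis by blast
  qed
  define q where "q x j k = y (LEAST n. meets_prefix (E k n) j x)" for x j k
  show ?thesis
  proof (intro exI[of _ "\<lambda>j x. finest_consistent (q x j) j"] conjI allI ballI)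
    show "general_algorithm binary_seqs pointwise_evals (\<lambda>x. finest_consistent (q x j) j)" for j
    proof (rule general_algorithm_of_prefix[of j])
      fix x z :: "nat \<Rightarrow> nat" assume "\<forall>i<j. z i = x i"
      then have "meets_prefix (E k n) j z \<longleftrightarrow> meets_prefix (E k n) j x" for k n
        by (rule meets_prefix_cong)
      then have "q z j = q x j"
        by (simp add: q_def fun_eq_iff)
      then show "finest_consistent (q z j) j = finest_consistent (q x j) j" by simp
    qed
  next
    fix x assume x: "x \<in> binary_seqs"
    show "(\<lambda>j. finest_consistent (q x j) j) \<longlonglongrightarrow> h x"
    proof (rule finest_consistent_tendsto)
      show "\<forall>\<^sub>F j in sequentially. dist (q x j k) (h x) < (1/2)^k" for k
        using eventually_least_meets_prefix[OF E_closed x E_cover[OF x], of k]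
        by eventually_elim (simp add: q_def E_near)
    qed
  qed
qed

section \<open>Towers and the levels of the Baire hierarchy\<close>

lemma is_tower_1_iff:
  "is_tower \<Omega> \<Lambda> \<Xi> 1 \<Gamma> \<longleftrightarrow>
     (\<forall>n. general_algorithm \<Omega> \<Lambda> (\<Gamma> [n])) \<and> (\<forall>a\<in>\<Omega>. (\<lambda>n. \<Gamma> [n] a) \<longlonglongrightarrow> \<Xi> a)"
  by (auto simp: is_tower_def length_Suc_conv)

lemma is_tower_Suc_iff:
  assumes "1 \<le> m"
  shows "is_tower \<Omega> \<Lambda> \<Xi> (Suc m) \<Gamma> \<longleftrightarrow>
    (\<forall>n. is_tower \<Omega> \<Lambda> (\<Gamma> [n]) m (\<lambda>ns. \<Gamma> (n # ns))) \<and> (\<forall>a\<in>\<Omega>. (\<lambda>n. \<Gamma> [n] a) \<longlonglongrightarrow> \<Xi> a)"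
  (is "?L \<longleftrightarrow> ?R")
proof
  assume L: ?L
  have "is_tower \<Omega> \<Lambda> (\<Gamma> [n]) m (\<lambda>ns. \<Gamma> (n # ns))" for n
  proof -
    have "(\<lambda>i. \<Gamma> ((n # ns) @ [i]) a) \<longlonglongrightarrow> \<Gamma> (n # ns) a" if "length ns < m" "a \<in> \<Omega>" for ns a
      using L that unfolding is_tower_def by (metis One_nat_def Suc_le_mono Suc_less_eq le0 length_Cons)
    moreover have "general_algorithm \<Omega> \<Lambda> (\<Gamma> (n # ns))" if "length ns = m" for ns
      using L that by (simp add: is_tower_def)
    moreover from calculation(1)[of "[]"] have "(\<lambda>i. \<Gamma> [n, i] a) \<longlonglongrightarrow> \<Gamma> [n] a" if "a \<in> \<Omega>" for a
      using assms that by simp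
    ultimately show ?thesis
      using assms by (simp add: is_tower_def)
  qed
  with L show ?R by (simp add: is_tower_def)
next
  assume R: ?R
  have "general_algorithm \<Omega> \<Lambda> (\<Gamma> ns)" if "length ns = Suc m" for ns
    using R that by (auto simp: is_tower_def length_Suc_conv)
  moreover have "(\<lambda>i. \<Gamma> (ns @ [i]) a) \<longlonglongrightarrow> \<Gamma> ns a"
    if ns: "1 \<le> length ns" "length ns < Suc m" and a: "a \<in> \<Omega>" for ns a
  proof -
    obtain n ns' where eq: "ns = n # ns'" using ns(1) by (cases ns) auto
    have T: "is_tower \<Omega> \<Lambda> (\<Gamma> [n]) m (\<lambda>ns. \<Gamma> (n # ns))" using R by blast
    show ?thesis
    proof (cases "ns' = []")
      case True
      then show ?thesis using T a by (simp add: eq is_tower_def)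
    next
      case False
      then have "1 \<le> length ns'" by (cases ns') auto
      then show ?thesis using T a ns(2) by (simp add: eq is_tower_def)
    qed
  qed
  ultimately show ?L using R by (simp add: is_tower_def)
qed

lemma baire_class_ge_1: "baire_class X m h \<Longrightarrow> 1 \<le> m"
  by (induction rule: baire_class.induct) auto

lemma baire_class_mono:
  assumes "baire_class X k h" "k \<le> m"
  shows "baire_class X m h"
proof (cases "k = m")
  case False
  then have "k < m" using assms(2) by simp
  then show ?thesis
    using assms(1) baire_class_ge_1[OF assms(1)]
    by (intro baire_limit[of m "\<lambda>_. k" X "\<lambda>_. h"]) auto
qed (use assms in simp)

lemma tower_imp_baire_class:
  assumes "is_tower binary_seqs pointwise_evals \<Xi> m \<Gamma>"
  shows "baire_class binary_topology m \<Xi>"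
proof -
  have "1 \<le> m" using assms by (simp add: is_tower_def)
  then show ?thesis
    using assms
  proof (induction m arbitrary: \<Xi> \<Gamma> rule: dec_induct)
    case base
    then have T: "\<And>n. general_algorithm binary_seqs pointwise_evals (\<Gamma> [n])"
      "\<And>a. a \<in> binary_seqs \<Longrightarrow> (\<lambda>n. \<Gamma> [n] a) \<longlonglongrightarrow> \<Xi> a"
      unfolding is_tower_1_iff by auto
    show ?case
    proof (rule baire_one)
      fix U :: "'a set" assume "open U"
      then show "fsigma_in binary_topology {x \<in> topspace binary_topology. \<Xi> x \<in> U}"
        using general_algorithm_closedin_preimage[OF T(1)] T(2)
        by (intro fsigma_in_preimage_pointwise_limit[of _ "\<lambda>n. \<Gamma> [n]"]) auto
    qed
  next
    case (step m)
    have T: "\<And>n. is_tower binary_seqs pointwise_evals (\<Gamma> [n]) m (\<lambda>ns. \<Gamma> (n # ns))"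
      "\<And>a. a \<in> binary_seqs \<Longrightarrow> (\<lambda>n. \<Gamma> [n] a) \<longlonglongrightarrow> \<Xi> a"
      using step.prems unfolding is_tower_Suc_iff[OF step.hyps(1)] by simp_all
    show ?case
    proof (rule baire_limit)
      show "baire_class binary_topology m (\<Gamma> [n])" for n
        by (rule step.IH[OF T(1)])
    qed (use step.hyps T(2) in simp_all)
  qed
qed

text \<open>
  The members of a sequence defining class \<open>m + 1\<close> may lie in different lower classes; raising them
  all to class \<open>m\<close> gives them towers of the same height, which can be put side by side.
\<close>

lemma baire_class_imp_tower:
  fixes \<Xi> :: "(nat \<Rightarrow> nat) \<Rightarrow> 'm::metric_space"
  assumes separable: "\<exists>D::'m set. countable D \<and> closure D = UNIV"
    and "baire_class binary_topology m \<Xi>"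
  shows "\<exists>\<Gamma>. is_tower binary_seqs pointwise_evals \<Xi> m \<Gamma>"
proof -
  have "1 \<le> m" using assms(2) by (rule baire_class_ge_1)
  then show ?thesis
    using assms(2)
  proof (induction m arbitrary: \<Xi> rule: dec_induct)
    case base
    then have fsigma: "fsigma_in binary_topology {x \<in> binary_seqs. \<Xi> x \<in> U}" if "open U" for U
      using that by (cases rule: baire_class.cases) auto
    have "\<exists>\<Gamma>. (\<forall>j. general_algorithm binary_seqs pointwise_evals (\<Gamma> j)) \<and>
        (\<forall>x\<in>binary_seqs. (\<lambda>j. \<Gamma> j x) \<longlonglongrightarrow> \<Xi> x)"
      by (rule baire_one_imp_limit_of_algorithms[OF separable]) (rule fsigma)
    then obtain \<Gamma> where \<Gamma>: "(\<forall>j. general_algorithm binary_seqs pointwise_evals (\<Gamma> j)) \<and>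
        (\<forall>x\<in>binary_seqs. (\<lambda>j. \<Gamma> j x) \<longlonglongrightarrow> \<Xi> x)"
      by (rule exE)
    have "is_tower binary_seqs pointwise_evals \<Xi> 1 (\<lambda>ns. \<Gamma> (hd ns))"
      using \<Gamma> unfolding is_tower_1_iff by simp
    then show ?case by blast
  next
    case (step m)
    obtain \<xi>s hs where hs: "\<And>n. \<xi>s n < Suc m"
        "\<And>n. baire_class binary_topology (\<xi>s n) (hs n)"
        "\<And>x. x \<in> binary_seqs \<Longrightarrow> (\<lambda>n. hs n x) \<longlonglongrightarrow> \<Xi> x"
      using step.prems
    proof (cases rule: baire_class.cases)
      case baire_one
      then show thesis using step.hyps by simp
    next
      case (baire_limit \<xi>s hs)
      then show thesis using that[of \<xi>s hs] by simp
    qed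
    have "baire_class binary_topology m (hs n)" for n
      using baire_class_mono[OF hs(2)] hs(1)[of n] by simp
    then have "\<exists>\<Gamma>. is_tower binary_seqs pointwise_evals (hs n) m \<Gamma>" for n
      by (rule step.IH)
    then have "\<exists>T. \<forall>n. is_tower binary_seqs pointwise_evals (hs n) m (T n)"
      by (rule choice[OF allI])
    then obtain T where T: "\<forall>n. is_tower binary_seqs pointwise_evals (hs n) m (T n)"
      by (rule exE)
    define \<Gamma> where "\<Gamma> ns = (if tl ns = [] then hs (hd ns) else T (hd ns) (tl ns))" for ns
    have "is_tower binary_seqs pointwise_evals (\<Gamma> [n]) m (\<lambda>ns. \<Gamma> (n # ns))" for n
      using T[rule_format, of n] by (auto simp: is_tower_def \<Gamma>_def)
    then have "is_tower binary_seqs pointwise_evals \<Xi> (Suc m) \<Gamma>"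
      using step.hyps hs(3) by (simp add: is_tower_Suc_iff \<Gamma>_def)
    then show ?case by blast
  qed
qed

theorem theorem5p17:
  fixes \<Xi> :: "(nat \<Rightarrow> nat) \<Rightarrow> 'm::metric_space" and m :: nat
  assumes separable: "\<exists>D::'m set. countable D \<and> closure D = UNIV"
    and two_points: "\<exists>x y::'m. x \<noteq> y"
    and "1 \<le> m"
  shows "(\<Xi>, binary_seqs, pointwise_evals) \<in> Delta_G (m + 1) \<longleftrightarrow> baire_class binary_topology m \<Xi>"
proof
  assume "(\<Xi>, binary_seqs, pointwise_evals) \<in> Delta_G (m + 1)"
  then obtain k \<Gamma> where "k \<le> m" "is_tower binary_seqs pointwise_evals \<Xi> k \<Gamma>"
    by (auto simp: Delta_G_def)
  then show "baire_class binary_topology m \<Xi>"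
    using tower_imp_baire_class baire_class_mono by blast
next
  assume "baire_class binary_topology m \<Xi>"
  then show "(\<Xi>, binary_seqs, pointwise_evals) \<in> Delta_G (m + 1)"
    using baire_class_imp_tower[OF separable] by (auto simp: Delta_G_def)
qed

end
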